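(* Let $g\ge1$. Then $\delta_g^{(2c)}$ is an (inhomogeneous) polynomial in $c$ and $p$ of total degree $2g-1$ (i.e. there is a polynomial with rational coefficients in two variables, depending only on $g$, whose value at $(c,p)$ is $\delta_g^{(2c)}$ for all primes $p\ge5$ and all integers $0\le c\le (p-3)/2$). The homogeneous part of degree $2g-1$ in this polynomial is $$(-1)^{g-1}\sum_{k=1}^{2g}2(2^k-1)\,\frac{B_k}{k!}\,\frac{c^{2g-k}}{(2g-k)!}\,p^{k-1}.$$ In particular, for any fixed value of $c$, the polynomial $\delta_g^{(2c)}(p)$ has degree $2g-1$ in $p$. Moreover, the leading coefficient of this polynomial in $p$ is $4(2^{2g}-1)\widetilde B_g$.
   Context: Bernoulli numbers are defined by $\frac{t}{e^t-1}=\sum_{n\ge0}B_n\frac{t^n}{n!}$ (so $B_1=-1/2$), and $\widetilde B_n=\frac12\frac{(-1)^{n+1}B_{2n}}{(2n)!}=\frac{\zeta(2n)}{(2\pi)^{2n}}$. Let $p\ge5$ be a prime, $d=(p-1)/2$, $0\le c\le d-1$. The lollipop tree $T_g^{(2c)}$ is the trivalent graph consisting of $g$ loops, the $i$-th loop attached to a stick edge, the sticks being attached successively to a spine ending in a free trunk edge colored $2c$. Its (small admissible) colorings are the families of integers $(a_1,\dots,a_g;\,l_1,\dots,l_g;\,k_0,\dots,k_g)$ (stick colors $2a_i$, loop colors $l_i$, spine colors $2k_i$) with $k_0=0$, $k_g=c$, such that for every $i=1,\dots,g$: $0\le a_i\le l_i\le d-1$, $|k_{i-1}-a_i|\le k_i\le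 k_{i-1}+a_i$, and $k_{i-1}+a_i+k_i\le 2d-1$ (with all $0\le k_i\le d-1$). (Here $k_1=a_1$: sticks 1 and 2 meet at the first vertex; edges colored $0$ may be erased.) A coloring is even or odd according as $c+\sum_{i=1}^g a_i$ is even or odd. Let $\mathfrak e_g^{(2c)}$ and $\mathfrak o_g^{(2c)}$ be the numbers of even and odd colorings respectively (they depend on $p$), and $\delta_g^{(2c)}=\mathfrak e_g^{(2c)}-\mathfrak o_g^{(2c)}$. *)

theory Defs
  imports Complex_Main "HOL-Library.FuncSet"
    "HOL-Computational_Algebra.Computational_Algebra"
begin

section \<open>Bernoulli numbers\<close>

text \<open>\<open>t / (e^t - 1) = \<Sum>n. B\<^sub>n t^n / n!\<close>, so that \<open>B\<^sub>1 = -1/2\<close>. The divisor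
  \<open>e^t - 1\<close> has subdegree 1, and the division of formal power series over a field cancels
  the common factor \<open>t\<close>, as intended.\<close>

definition bernoulli :: "nat \<Rightarrow> rat" where
  "bernoulli n = fact n * fps_nth (fps_X / (fps_exp 1 - 1)) n"

definition bernoulli_tilde :: "nat \<Rightarrow> rat" where
  "bernoulli_tilde n = 1/2 * ((-1) ^ (n + 1) * bernoulli (2 * n) / fact (2 * n))"


section \<open>Colorings of the lollipop tree\<close>

text \<open>A coloring is a triple \<open>(a, l, k)\<close>: the sticks have colors \<open>2 a\<^sub>i\<close>, the loops \<open>l\<^sub>i\<close>
  (\<open>1 \<le> i \<le> g\<close>) and the spine edges \<open>2 k\<^sub>i\<close> (\<open>0 \<le> i \<le> g\<close>). The families are extensional
  functions, so that distinct triples are distinct families on the index sets.\<close>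

definition colorings :: "nat \<Rightarrow> nat \<Rightarrow> nat \<Rightarrow> ((nat \<Rightarrow> int) \<times> (nat \<Rightarrow> int) \<times> (nat \<Rightarrow> int)) set" where
  "colorings p g c = (let d = (int p - 1) div 2 in
     {(a, l, k).
        a \<in> extensional {1..g} \<and> l \<in> extensional {1..g} \<and> k \<in> extensional {0..g} \<and>
        k 0 = 0 \<and> k g = int c \<and>
        (\<forall>i\<in>{0..g}. 0 \<le> k i \<and> k i \<le> d - 1) \<and>
        (\<forall>i\<in>{1..g}.
           0 \<le> a i \<and> a i \<le> l i \<and> l i \<le> d - 1 \<and>
           \<bar>k (i - 1) - a i\<bar> \<le> k i \<and> k i \<le> k (i - 1) + a i \<and>
           k (i - 1) + a i + k i \<le> 2 * d - 1)})"

definition num_even :: "nat \<Rightarrow> nat \<Rightarrow> nat \<Rightarrow> nat" where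
  "num_even p g c = card {(a, l, k) \<in> colorings p g c. even (int c + (\<Sum>i=1..g. a i))}"

definition num_odd :: "nat \<Rightarrow> nat \<Rightarrow> nat \<Rightarrow> nat" where
  "num_odd p g c = card {(a, l, k) \<in> colorings p g c. odd (int c + (\<Sum>i=1..g. a i))}"

definition \<delta> :: "nat \<Rightarrow> nat \<Rightarrow> nat \<Rightarrow> int" where
  "\<delta> p g c = int (num_even p g c) - int (num_odd p g c)"


section \<open>Polynomials in the two variables \<open>c\<close> and \<open>p\<close>\<close>

text \<open>An element of \<^typ>\<open>rat poly poly\<close> is a polynomial in \<open>c\<close> (outer variable) whose
  coefficients are polynomials in \<open>p\<close> (inner variable), i.e. the coefficient of \<open>c^i p^j\<close> in
  \<open>P\<close> is \<open>coeff (coeff P i) j\<close>.\<close>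

definition bimonom :: "rat \<Rightarrow> nat \<Rightarrow> nat \<Rightarrow> rat poly poly" where
  "bimonom q i j = monom (monom q j) i"

text \<open>The specialization at a value of \<open>c\<close>, as a polynomial in \<open>p\<close>.\<close>

definition fix_c :: "rat poly poly \<Rightarrow> rat \<Rightarrow> rat poly" where
  "fix_c P c = poly P [:c:]"

definition eval2 :: "rat poly poly \<Rightarrow> rat \<Rightarrow> rat \<Rightarrow> rat" where
  "eval2 P c p = poly (fix_c P c) p"

text \<open>As for \<^const>\<open>degree\<close>, the zero polynomial is given total degree \<open>0\<close>.\<close>

definition total_degree :: "rat poly poly \<Rightarrow> nat" where
  "total_degree P = Max (insert 0 {i + j | i j. coeff (coeff P i) j \<noteq> 0})"

definition homogeneous_part :: "nat \<Rightarrow> rat poly poly \<Rightarrow> rat poly poly" where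
  "homogeneous_part n P = (\<Sum>i\<le>n. bimonom (coeff (coeff P i) (n - i)) i (n - i))"

end

theory Submission
  imports Defs
begin

text \<open>
  Write \<open>p = 2 d + 1\<close>. Cutting off the last lollipop expresses the signed count
  \<open>\<delta>\<^sub>g\<^sub>+\<^sub>1(c)\<close> through the \<open>\<delta>\<^sub>g(m)\<close> with \<open>m < d\<close>: the colors of the last loop and the last stick contribute
  an alternating sum which collapses to \<open>d - max c m\<close>, whichever of the two upper bounds on the stick color
  is the active one. As \<open>d - max c m\<close> counts the \<open>j\<close> with \<open>c, m < j \<le> d\<close>, the recursion reads
  \<open>\<delta>\<^sub>g\<^sub>+\<^sub>1(c) = \<Sum>\<^bsub>c<j\<le>d\<^esub> \<Sum>\<^bsub>k<j\<^esub> \<delta>\<^sub>g(k)\<close>, starting from \<open>\<delta>\<^sub>1(c) = d - c\<close>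
  (lemmas \<open>\<delta>_Suc_double_sum\<close> and \<open>\<delta>_1\<close>). Summation sends polynomials to polynomials, so
  \<open>\<delta>\<^sub>g\<close> is a polynomial in \<open>c\<close> and \<open>d = (p - 1) / 2\<close>.

  On top-degree parts, a sum acts as an integral: if \<open>f\<^sub>g\<close> is the part of \<open>\<delta>\<^sub>g\<close> of degree
  \<open>2 g - 1\<close>, then \<open>f\<^sub>g\<^sub>+\<^sub>1(c) = \<integral>\<^bsub>c\<^esub>\<^bsup>p/2\<^esup> \<integral>\<^bsub>0\<^esub>\<^bsup>j\<^esup> f\<^sub>g(k) dk dj\<close>. Equivalently, as functions of \<open>c\<close>,
  \<open>f\<^sub>g\<^sub>+\<^sub>1'' = - f\<^sub>g\<close>, \<open>f\<^sub>g\<^sub>+\<^sub>1'(0) = 0\<close> and \<open>f\<^sub>g\<^sub>+\<^sub>1(p/2) = 0\<close> (lemma \<open>double_summation_poly\<close>).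
  The form in the theorem solves this problem. With \<open>b\<^sub>k = 2 (2^k - 1) B\<^sub>k / k!\<close>, the differential equation is
  visible from the shape of the formula; the condition at \<open>0\<close> says \<open>b\<^sub>k = 0\<close> for odd \<open>k \<ge> 3\<close>; the condition
  at \<open>p/2\<close> says that \<open>\<Sum> b\<^sub>k t^k \<cdot> e^(t/2) = - t / cosh (t/2)\<close> is an odd series.

  Finally, the coefficient \<open>\<plusminus> b\<^bsub>2g\<^esub>\<close> of \<open>p^(2g-1)\<close> has to be nonzero. It is a Taylor coefficient
  of \<open>tanh (t/2) = 1 - 2 / (e^t + 1)\<close>, and the Riccati equation \<open>2 y' = 1 - y\<^sup>2\<close> forces the odd
  Taylor coefficients of this series to alternate strictly in sign.
\<close>

section \<open>The numbers \<open>2 (2^k - 1) B\<^sub>k / k!\<close> and the hyperbolic tangent\<close>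

text \<open>
  These are the Genocchi numbers divided by \<open>- k!\<close>; their generating function is \<open>- 2 t / (e^t + 1)\<close>.
\<close>
definition genocchi_coeff :: "nat \<Rightarrow> rat" where
  "genocchi_coeff k = 2 * (2 ^ k - 1) * (bernoulli k / fact k)"

text \<open>
  The generating function divided by \<open>t\<close>, that is \<open>- 2 / (e^t + 1)\<close> (lemma \<open>genocchi_gf_equation\<close> below).
\<close>
definition genocchi_gf :: "rat fps" where
  "genocchi_gf = Abs_fps (\<lambda>n. genocchi_coeff (Suc n))"

text \<open>
  The series of \<open>tanh (t/2) = 1 - 2 / (e^t + 1)\<close>.
\<close>
definition tanh_half :: "rat fps" where "tanh_half = 1 + genocchi_gf"

lemma bernoulli_gf: "Abs_fps (\<lambda>n. bernoulli n / fact n) * (fps_exp 1 - 1) = fps_X"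
proof -
  have sub: "subdegree (fps_exp 1 - 1 :: rat fps) = 1"
    by (rule subdegreeI) auto
  have "(fps_exp 1 - 1 :: rat fps) dvd fps_X"
    using sub by (subst fps_dvd_iff) (auto dest: arg_cong[where f = subdegree])
  moreover have "Abs_fps (\<lambda>n. bernoulli n / fact n) = fps_X / (fps_exp 1 - 1)"
    by (rule fps_ext) (simp add: bernoulli_def)
  ultimately show ?thesis by (simp add: dvd_div_mult_self)
qed

text \<open>
  With \<open>B(t) = t / (e^t - 1)\<close>, the generating function of the \<open>b\<^sub>k\<close> is \<open>2 (B(2t) - B(t))\<close>. Multiplication by
  \<open>e^(2t) - 1 = (e^t - 1) (e^t + 1)\<close> clears both denominators.
\<close>
lemma genocchi_gf_equation: "genocchi_gf * (fps_exp 1 + 1) = -2"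
proof -
  define B where "B = Abs_fps (\<lambda>n. bernoulli n / fact n)"
  define D where "D = fps_compose B (fps_const 2 * fps_X)"
  let ?E = "fps_exp 1 :: rat fps"
  have B: "B * (?E - 1) = fps_X"
    unfolding B_def by (rule bernoulli_gf)
  have sq: "fps_compose ?E (fps_const 2 * fps_X) = ?E * ?E"
    by (simp add: fps_exp_add_mult [symmetric])
  have "fps_compose (B * (?E - 1)) (fps_const 2 * fps_X) = fps_const 2 * fps_X"
    by (simp add: B)
  hence D: "D * (?E * ?E - 1) = fps_const 2 * fps_X"
    by (subst (asm) fps_compose_mult_distrib)
       (simp_all only: D_def fps_compose_sub_distrib sq fps_compose_1, simp_all)
  have D_nth: "fps_nth D n = 2 ^ n * (bernoulli n / fact n)" for n
    by (simp add: D_def B_def fps_nth_compose_linear)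
  have "fps_nth (fps_X * genocchi_gf) n = fps_nth (fps_const 2 * (D - B)) n" for n
  proof (cases n)
    case (Suc m)
    hence "fps_nth (fps_X * genocchi_gf) n = genocchi_coeff n" by (simp add: genocchi_gf_def)
    also have "\<dots> = 2 * (fps_nth D n - fps_nth B n)"
      by (simp only: D_nth B_def genocchi_coeff_def fps_nth_Abs_fps left_diff_distrib mult_1 mult.assoc)
    finally show ?thesis by simp
  qed (simp add: D_nth B_def)
  hence "fps_X * genocchi_gf = fps_const 2 * (D - B)" by (rule fps_ext)
  hence "fps_X * genocchi_gf * (?E + 1) * (?E - 1) = fps_const 2 * (D - B) * (?E + 1) * (?E - 1)"
    by simp
  also have "\<dots> = fps_const 2 * (D * (?E * ?E - 1) - B * (?E - 1) * (?E + 1))"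
    by (simp add: algebra_simps)
  also have "\<dots> = fps_const 2 * (fps_const 2 * fps_X - fps_X * (?E + 1))"
    by (simp only: B D)
  also have "\<dots> = fps_X * (-2) * (?E - 1)"
    by (simp add: algebra_simps fps_numeral_fps_const [symmetric] flip: numeral_fps_const)
  finally have "fps_X * (?E - 1) * (genocchi_gf * (?E + 1)) = fps_X * (?E - 1) * (-2)"
    by (simp add: algebra_simps)
  moreover have "?E - 1 \<noteq> 0"
    by (metis B mult_zero_right fps_X_neq_zero)
  ultimately show ?thesis
    by (metis mult_cancel_left fps_X_neq_zero mult_eq_0_iff)
qed

text \<open>
  Obtained by differentiating the equation for \<open>- 2 / (e^t + 1)\<close> above and eliminating \<open>e^t\<close> by the same
  equation.
\<close>
lemma genocchi_gf_deriv: "2 * fps_deriv genocchi_gf = - genocchi_gf - genocchi_gf * tanh_half"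
proof -
  let ?E = "fps_exp 1 :: rat fps"
  have "fps_deriv (genocchi_gf * (?E + 1)) = 0"
    by (simp only: genocchi_gf_equation) simp
  hence *: "fps_deriv genocchi_gf * (?E + 1) + genocchi_gf * ?E = 0"
    by (simp add: algebra_simps)
  have "(?E + 1) * (2 * fps_deriv genocchi_gf + genocchi_gf + genocchi_gf * tanh_half)
      = 2 * (fps_deriv genocchi_gf * (?E + 1) + genocchi_gf * ?E) + genocchi_gf * (2 + genocchi_gf * (?E + 1))"
    by (simp add: tanh_half_def algebra_simps)
  also have "\<dots> = 0" by (simp add: * genocchi_gf_equation)
  finally have "2 * fps_deriv genocchi_gf + genocchi_gf + genocchi_gf * tanh_half = 0"
    using genocchi_gf_equation by (metis mult_eq_0_iff mult_zero_right neg_equal_0_iff_equal zero_neq_numeral)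
  thus ?thesis by (simp add: algebra_simps eq_neg_iff_add_eq_0)
qed

lemma tanh_half_riccati: "2 * fps_deriv tanh_half = 1 - tanh_half * tanh_half"
  using genocchi_gf_deriv by (simp add: tanh_half_def algebra_simps)

lemma tanh_half_nth_0: "fps_nth tanh_half 0 = 0"
proof -
  have "fps_nth (genocchi_gf * (fps_exp 1 + 1)) 0 = -2" by (simp add: genocchi_gf_equation)
  thus ?thesis by (simp add: tanh_half_def)
qed

text \<open>
  The Riccati equation read as a recursion for the coefficients: from it come both the parity and the signs.
\<close>
lemma tanh_half_nth_Suc:
  "2 * of_nat (Suc n) * fps_nth tanh_half (Suc n) = (if n = 0 then 1 else 0) - (\<Sum>i=0..n. fps_nth tanh_half i * fps_nth tanh_half (n - i))"
proof -
  have "fps_nth (2 * fps_deriv tanh_half) n = fps_nth (1 - tanh_half * tanh_half) n" by (simp add: tanh_half_riccati)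
  moreover have "fps_nth (2 * fps_deriv tanh_half) n = 2 * of_nat (Suc n) * fps_nth tanh_half (Suc n)"
    by (simp add: numeral_fps_const)
  ultimately show ?thesis by (simp add: fps_mult_nth)
qed

lemma tanh_half_nth_even: "even n \<Longrightarrow> fps_nth tanh_half n = 0"
proof (induction n rule: less_induct)
  case (less n)
  show ?case
  proof (cases n)
    case (Suc m)
    have "fps_nth tanh_half i * fps_nth tanh_half (m - i) = 0" if "i \<le> m" for i
      using less that Suc by (cases "even i") (auto)
    hence "(\<Sum>i=0..m. fps_nth tanh_half i * fps_nth tanh_half (m - i)) = 0"
      by (intro sum.neutral) auto
    thus ?thesis using tanh_half_nth_Suc[of m] less.prems Suc by (auto simp del: of_nat_Suc split: if_splits)
  qed (simp add: tanh_half_nth_0)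
qed

text \<open>
  For positive \<open>n\<close>, the coefficient with index \<open>2 n + 1\<close> is a negative multiple of the sum of the products of
  two coefficients with indices \<open>i\<close> and \<open>2 n - i\<close>. The products with \<open>i\<close> even vanish and those
  with \<open>i\<close> odd all have the sign \<open>(-1)^(n-1)\<close>, so nothing cancels.
\<close>
lemma tanh_half_nth_odd_sign: "(-1) ^ n * fps_nth tanh_half (2 * n + 1) > 0"
proof (induction n rule: less_induct)
  case (less n)
  show ?case
  proof (cases n)
    case 0
    thus ?thesis using tanh_half_nth_Suc[of 0] tanh_half_nth_0 by simp
  next
    case (Suc m)
    have t: "(-1) ^ m * (fps_nth tanh_half i * fps_nth tanh_half (2 * n - i)) \<ge> 0" if "i \<le> 2 * n" for i
    proof (cases "even i")
      case False
      then obtain j where j: "i = 2 * j + 1" by (elim oddE)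
      with that Suc have *: "2 * n - i = 2 * (m - j) + 1" "j \<le> m" by auto
      have "(-1) ^ m * (fps_nth tanh_half i * fps_nth tanh_half (2 * n - i))
        = ((-1) ^ j * fps_nth tanh_half (2 * j + 1)) * ((-1) ^ (m - j) * fps_nth tanh_half (2 * (m - j) + 1))"
        using *(2) unfolding j[symmetric] * by (simp flip: power_add)
      moreover have "\<dots> > 0"
        by (intro mult_pos_pos less.IH) (use * Suc in auto)
      ultimately show ?thesis by simp
    qed (simp add: tanh_half_nth_even)
    have "0 < (-1) ^ m * (fps_nth tanh_half 1 * fps_nth tanh_half (2 * n - 1))"
      using mult_pos_pos[OF less.IH[of 0] less.IH[of m]] Suc by (simp add: mult_ac)
    also have "\<dots> \<le> (\<Sum>i=0..2 * n. (-1) ^ m * (fps_nth tanh_half i * fps_nth tanh_half (2 * n - i)))"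
      by (rule member_le_sum) (use Suc t in auto)
    also have "\<dots> = (-1) ^ m * (\<Sum>i=0..2 * n. fps_nth tanh_half i * fps_nth tanh_half (2 * n - i))"
      by (simp only: sum_distrib_left)
    also have "(\<Sum>i=0..2 * n. fps_nth tanh_half i * fps_nth tanh_half (2 * n - i)) = - (2 * of_nat (2 * n + 1) * fps_nth tanh_half (2 * n + 1))"
      using tanh_half_nth_Suc[of "2 * n"] Suc by simp
    also have "(-1) ^ m * \<dots> = (-1) ^ n * (2 * of_nat (2 * n + 1) * fps_nth tanh_half (2 * n + 1))"
      using Suc by simp
    finally show ?thesis
      by (simp add: mult.left_commute[of "(-1) ^ n"] zero_less_mult_iff mult.assoc)
  qed
qed

text \<open>
  The series \<open>V = - 2 e^(t/2) / (e^t + 1) = - 1 / cosh (t/2)\<close> is even: it satisfies \<open>2 V' = - tanh (t/2) V\<close>,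
  and an odd coefficient of \<open>V\<close> is thereby determined by the earlier odd ones because \<open>tanh\<close> is odd.
\<close>
lemma genocchi_gf_exp_half_nth_odd:
  assumes "odd n"
  shows "fps_nth (genocchi_gf * fps_exp (1/2)) n = 0"
  using assms
proof (induction n rule: less_induct)
  case (less n)
  define V where "V = genocchi_gf * fps_exp (1/2 :: rat)"
  have "2 * fps_deriv V = (2 * fps_deriv genocchi_gf) * fps_exp (1/2) + 2 * (fps_const (1/2) * V)"
    by (simp add: V_def algebra_simps)
  also have "2 * (fps_const (1/2) * V) = V"
    by (rule fps_ext) (simp add: numeral_fps_const)
  also have "(2 * fps_deriv genocchi_gf) * fps_exp (1/2) + V = - (tanh_half * V)"
    unfolding genocchi_gf_deriv by (simp add: V_def algebra_simps)
  finally have V': "2 * fps_deriv V = - (tanh_half * V)" .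
  from less.prems obtain m where m: "n = Suc m" "even m" by (cases n) auto
  have "fps_nth tanh_half i * fps_nth V (m - i) = 0" if "i \<le> m" for i
    using less.IH[of "m - i"] tanh_half_nth_even[of i] that m V_def by (cases "even i") auto
  hence "fps_nth (tanh_half * V) m = 0"
    unfolding fps_mult_nth by (intro sum.neutral) auto
  moreover have "fps_nth (2 * fps_deriv V) m = 2 * of_nat n * fps_nth V n"
    by (simp add: numeral_fps_const m)
  ultimately have "2 * of_nat n * fps_nth V n = 0" unfolding V' by simp
  thus ?case using m by (simp add: V_def del: of_nat_Suc)
qed

lemma genocchi_coeff_1: "genocchi_coeff 1 = -1"
  using tanh_half_nth_0 by (simp add: tanh_half_def genocchi_gf_def)

lemma genocchi_coeff_odd: "odd k \<Longrightarrow> k \<noteq> 1 \<Longrightarrow> genocchi_coeff k = 0"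
  using tanh_half_nth_even[of "k - 1"] by (cases k) (auto simp: tanh_half_def genocchi_gf_def)

lemma genocchi_coeff_even_sign: "g \<ge> 1 \<Longrightarrow> (-1) ^ (g - 1) * genocchi_coeff (2 * g) > 0"
  using tanh_half_nth_odd_sign[of "g - 1"] by (cases g) (auto simp: tanh_half_def genocchi_gf_def)

text \<open>
  Up to sign, the sum is the claimed leading form at \<open>c = 1/2\<close>, \<open>p = 1\<close>; it is an odd coefficient of the even
  series \<open>- 1 / cosh (t/2)\<close>.
\<close>
lemma genocchi_coeff_sum:
  assumes "g \<ge> 1"
  shows "(\<Sum>i\<le>2 * g - 1. genocchi_coeff (2 * g - i) / fact i * (1/2) ^ i) = 0"
proof -
  have "fps_nth (genocchi_gf * fps_exp (1/2)) (2 * g - 1) = (\<Sum>i=0..2 * g - 1. genocchi_coeff (Suc i) * ((1/2) ^ (2 * g - 1 - i) / fact (2 * g - 1 - i)))"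
    by (simp add: fps_mult_nth genocchi_gf_def)
  also have "\<dots> = (\<Sum>i\<le>2 * g - 1. genocchi_coeff (2 * g - i) / fact i * (1/2) ^ i)"
    by (rule sum.reindex_bij_witness[of _ "\<lambda>i. 2 * g - 1 - i" "\<lambda>i. 2 * g - 1 - i"])
       (use assms in \<open>auto simp: Suc_diff_le\<close>)
  finally show ?thesis using genocchi_gf_exp_half_nth_odd[of "2 * g - 1"] assms by simp
qed

section \<open>Summation of polynomials and their leading forms\<close>

text \<open>
  The total degree of \<open>P\<close> is at most \<open>n\<close>, and its part of degree \<open>n\<close> is \<open>\<Sum>\<^bsub>i\<le>n\<^esub> L i c^i p^(n-i)\<close>.
  As \<open>L\<close> may vanish, \<open>n\<close> is just a bound for the degree. For \<open>p = 1\<close> such a form is a polynomial in the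
  single variable \<open>c\<close>, which makes integration and the substitution \<open>c = p/2\<close> easy to express.
\<close>
definition has_top_form :: "nat \<Rightarrow> (nat \<Rightarrow> rat) \<Rightarrow> rat poly poly \<Rightarrow> bool" where
  "has_top_form n L P \<longleftrightarrow>
     (\<forall>i j. n < i + j \<longrightarrow> coeff (coeff P i) j = 0) \<and> (\<forall>i\<le>n. coeff (coeff P i) (n - i) = L i)"

lemma has_top_form_iff:
  "has_top_form n L P \<longleftrightarrow> (\<forall>i j. n \<le> i + j \<longrightarrow> coeff (coeff P i) j = (if i + j = n then L i else 0))"
  unfolding has_top_form_def
  by (auto) (metis le_add1 add_diff_cancel_left' le_eq_less_or_eq)+

text \<open>
  Faulhaber's polynomials exist by induction on the exponent: summing
  \<open>(m + 1)^(k+1) - m^(k+1) = \<Sum>\<^bsub>j\<le>k\<^esub> (k+1 choose j) m^j\<close> over \<open>m < n\<close> telescopes to \<open>n^(k+1)\<close> and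
  expresses the sum of \<open>k\<close>-th powers by lower ones.
\<close>
lemma power_sum_poly:
  "\<exists>s :: rat poly. degree s \<le> Suc k \<and> coeff s (Suc k) = 1 / of_nat (Suc k) \<and>
     (\<forall>n. poly s (of_nat n) = (\<Sum>m<n. of_nat m ^ k))"
proof (induction k rule: less_induct)
  case (less k)
  then obtain s where s: "\<And>j. j < k \<Longrightarrow> degree (s j :: rat poly) \<le> Suc j"
    "\<And>j n. j < k \<Longrightarrow> poly (s j) (of_nat n) = (\<Sum>m<n. of_nat m ^ j)"
    by metis
  define R where "R = (\<Sum>j<k. smult (of_nat (Suc k choose j)) (s j))"
  define t where "t = smult (1 / of_nat (Suc k)) (monom 1 (Suc k) - R)"
  have "degree R \<le> k" unfolding R_def
    by (rule degree_sum_le) (use s(1) in \<open>auto intro: order.trans[OF degree_smult_le] order.trans[OF s(1)]\<close>)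
  hence "degree t \<le> Suc k" and "coeff t (Suc k) = 1 / of_nat (Suc k)"
    unfolding t_def by (auto intro!: order.trans[OF degree_smult_le] degree_diff_le
        simp: degree_monom_eq coeff_eq_0)
  moreover have "poly t (of_nat n) = (\<Sum>m<n. of_nat m ^ k)" for n
  proof -
    have step: "(of_nat (Suc m) :: rat) ^ Suc k - of_nat m ^ Suc k
        = (\<Sum>j<k. of_nat (Suc k choose j) * of_nat m ^ j) + of_nat (Suc k) * of_nat m ^ k" for m
    proof -
      have "(of_nat m + 1 :: rat) ^ Suc k = (\<Sum>j\<le>Suc k. of_nat (Suc k choose j) * of_nat m ^ j)"
        by (subst binomial_ring) simp
      also have "\<dots> = (\<Sum>j<k. of_nat (Suc k choose j) * of_nat m ^ j) + of_nat (Suc k) * of_nat m ^ k + of_nat m ^ Suc k"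
        by (simp only: sum.atMost_Suc lessThan_Suc_atMost[symmetric] sum.lessThan_Suc binomial_Suc_n binomial_n_n of_nat_1 mult_1)
      finally show ?thesis by (simp add: add.commute)
    qed
    have "(of_nat n :: rat) ^ Suc k = (\<Sum>m<n. of_nat (Suc m) ^ Suc k - of_nat m ^ Suc k)"
      by (subst sum_lessThan_telescope) simp
    also have "\<dots> = (\<Sum>m<n. \<Sum>j<k. of_nat (Suc k choose j) * of_nat m ^ j) + of_nat (Suc k) * (\<Sum>m<n. of_nat m ^ k)"
      by (simp only: step sum.distrib sum_distrib_left)
    also have "(\<Sum>m<n. \<Sum>j<k. of_nat (Suc k choose j) * of_nat m ^ j) = poly R (of_nat n :: rat)"
      by (subst sum.swap) (simp add: R_def poly_sum s(2) sum_distrib_left)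
    finally show ?thesis unfolding t_def by (simp add: poly_monom field_simps del: of_nat_Suc)
  qed
  ultimately show ?case by blast
qed

lemma fix_c_sum: "fix_c P c = (\<Sum>i\<le>degree P. smult (c ^ i) (coeff P i))"
  by (simp add: fix_c_def poly_altdef mult.commute poly_const_pow)

text \<open>
  Summation in \<open>c\<close> replaces \<open>c^k\<close> by a polynomial with leading term \<open>c^(k+1) / (k+1)\<close>. Hence it raises the total
  degree by one, and on leading forms it is the integral from \<open>0\<close>.
\<close>
lemma summation_poly:
  assumes "has_top_form n L P"
  shows "\<exists>Q. has_top_form (Suc n) (\<lambda>i. if i = 0 then 0 else L (i - 1) / of_nat i) Q \<and>
    (\<forall>m. fix_c Q (of_nat m) = (\<Sum>k<m. fix_c P (of_nat k)))"
proof -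
  obtain s where s: "\<And>k. degree (s k :: rat poly) \<le> Suc k"
    "\<And>k. coeff (s k) (Suc k) = 1 / of_nat (Suc k)"
    "\<And>k n. poly (s k) (of_nat n) = (\<Sum>m<n. of_nat m ^ k)"
    using power_sum_poly by metis
  define lift where "lift = (map_poly (\<lambda>q. [:q:]) :: rat poly \<Rightarrow> rat poly poly)"
  have coeff_lift: "coeff (lift q) i = [:coeff q i:]" for q i
    by (simp add: lift_def coeff_map_poly)
  have poly_lift: "poly (lift q) [:x:] = [:poly q x:]" for q x
    unfolding lift_def by (induction q) (auto simp: map_poly_pCons)
  define Q where "Q = (\<Sum>k\<le>degree P. smult (coeff P k) (lift (s k)))"
  have cQ: "coeff (coeff Q i) j = (\<Sum>k\<le>degree P. coeff (s k) i * coeff (coeff P k) j)" for i j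
    by (simp add: Q_def coeff_sum coeff_lift)
  have top: "coeff (coeff Q i) j = (if i + j = Suc n then if i = 0 then 0 else L (i - 1) / of_nat i else 0)"
    if ij: "Suc n \<le> i + j" for i j
  proof -
    have z: "coeff (s k) i * coeff (coeff P k) j = 0" if "i + j \<noteq> Suc n \<or> i \<noteq> Suc k" for k
    proof (cases "n < k + j")
      case True
      thus ?thesis using assms by (simp add: has_top_form_def)
    next
      case False
      hence "degree (s k) < i" using that ij s(1)[of k] by auto
      thus ?thesis by (simp add: coeff_eq_0)
    qed
    show ?thesis
    proof (cases "i + j = Suc n \<and> i \<noteq> 0")
      case True
      then obtain r where r: "i = Suc r" by (cases i) auto
      have "coeff (coeff Q i) j = (\<Sum>k\<le>degree P. if k = r then coeff (s r) i * coeff (coeff P r) j else 0)"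
        unfolding cQ by (rule sum.cong) (use z r in auto)
      also have "\<dots> = coeff (s r) i * coeff (coeff P r) j"
        by (auto simp: coeff_eq_0)
      also have "coeff (coeff P r) j = L r"
        using assms True r by (auto simp: has_top_form_iff)
      finally show ?thesis using True r s(2)[of r] by simp
    next
      case False
      hence "coeff (coeff Q i) j = 0" unfolding cQ using z by (intro sum.neutral) auto
      thus ?thesis using False by auto
    qed
  qed
  have "fix_c Q (of_nat m) = (\<Sum>k<m. fix_c P (of_nat k))" for m
  proof -
    have "fix_c Q (of_nat m) = (\<Sum>i\<le>degree P. smult (\<Sum>k<m. of_nat k ^ i) (coeff P i))"
      by (simp add: fix_c_def Q_def poly_sum poly_lift s(3))
    also have "\<dots> = (\<Sum>k<m. fix_c P (of_nat k))"
      unfolding fix_c_sum by (subst sum.swap) (simp add: smult_sum)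
    finally show ?thesis .
  qed
  moreover have "has_top_form (Suc n) (\<lambda>i. if i = 0 then 0 else L (i - 1) / of_nat i) Q"
    unfolding has_top_form_iff using top by blast
  ultimately show ?thesis by blast
qed

lemma poly_poly_const: "poly (poly H q) x = eval2 H (poly q x) x"
  unfolding eval2_def fix_c_def by (induction H) auto

lemma coeff_mult_degree_le:
  fixes p q :: "'a :: comm_semiring_0 poly"
  assumes "degree p \<le> a" "degree q \<le> b"
  shows "coeff (p * q) (a + b) = coeff p a * coeff q b"
proof -
  have "coeff p i * coeff q (a + b - i) = 0" if "i \<noteq> a" for i
  proof (cases "i < a")
    case True
    hence "coeff q (a + b - i) = 0" using assms by (intro coeff_eq_0) auto
    thus ?thesis by simp
  next
    case False
    hence "coeff p i = 0" using that assms by (intro coeff_eq_0) auto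
    thus ?thesis by simp
  qed
  hence "coeff (p * q) (a + b) = (\<Sum>i\<le>a + b. if i = a then coeff p a * coeff q b else 0)"
    unfolding coeff_mult by (intro sum.cong) auto
  thus ?thesis by simp
qed

lemma coeff_linear_power: "coeff ([:a, b:] ^ i) i = (b :: rat) ^ i"
proof (induction i)
  case (Suc i)
  have "coeff ([:a, b:] * [:a, b:] ^ i) (1 + i) = coeff [:a, b:] 1 * coeff ([:a, b:] ^ i) i"
    by (rule coeff_mult_degree_le) (auto intro: order.trans[OF degree_power_le])
  thus ?case using Suc by simp
qed simp

text \<open>
  Only the slope \<open>b\<close> of \<open>c = a + b p\<close> is seen by the leading form. This is used for \<open>c = d = (p - 1) / 2\<close>
  and, with \<open>b = 0\<close>, for constant \<open>c\<close>.
\<close>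
lemma has_top_form_subst_linear:
  assumes "has_top_form n L P"
  shows "degree (poly P [:a, b:]) \<le> n"
    and "coeff (poly P [:a, b:]) n = (\<Sum>i\<le>n. L i * b ^ i)"
proof -
  have P: "coeff P i = 0" if "i > n" for i
    using assms that by (intro poly_eqI) (simp add: has_top_form_def)
  hence deg: "degree P \<le> n" by (intro degree_le) auto
  have dc: "degree (coeff P i) \<le> n - i" if "i \<le> n" for i
    using assms that by (intro degree_le) (auto simp: has_top_form_def)
  have dp: "degree ([:a, b:] ^ i) \<le> i" for i
    by (rule order.trans[OF degree_power_le]) simp
  have eq: "poly P [:a, b:] = (\<Sum>i\<le>n. coeff P i * [:a, b:] ^ i)"
    unfolding poly_altdef using deg by (intro sum.mono_neutral_left) (auto simp: coeff_eq_0)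
  show "degree (poly P [:a, b:]) \<le> n" unfolding eq
  proof (rule degree_sum_le)
    fix i assume "i \<in> {..n}"
    hence "degree (coeff P i) + degree ([:a, b:] ^ i) \<le> (n - i) + i"
      by (intro add_mono dc dp) auto
    also have "\<dots> = n" using \<open>i \<in> _\<close> by simp
    finally show "degree (coeff P i * [:a, b:] ^ i) \<le> n"
      by (rule order.trans[OF degree_mult_le])
  qed simp
  have "coeff (coeff P i * [:a, b:] ^ i) n = L i * b ^ i" if "i \<le> n" for i
    using coeff_mult_degree_le[OF dc[OF that] dp[of i]] assms that
    by (simp add: coeff_linear_power has_top_form_def)
  thus "coeff (poly P [:a, b:]) n = (\<Sum>i\<le>n. L i * b ^ i)"
    by (simp add: eq coeff_sum)
qed

lemma has_top_form_add_lower: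
  assumes "has_top_form (Suc n) L P" "has_top_form n L' Q"
  shows "has_top_form (Suc n) L (P + Q)"
  using assms by (auto simp: has_top_form_def)

text \<open>
  The hypotheses on \<open>L'\<close> are the boundary value problem \<open>(L')'' = - L\<close> with zero derivative at \<open>0\<close> and zero value at
  \<open>1/2\<close> (with \<open>p = 1\<close>), which determines the new leading form. If \<open>H(c) = \<Sum>\<^bsub>j\<le>c\<^esub> \<Sum>\<^bsub>k<j\<^esub> P(k)\<close>, then the double
  sum from \<open>c + 1\<close> to \<open>d\<close> is \<open>H(d) - H(c)\<close>. The first term is free of \<open>c\<close>; it only affects the constant
  coefficient \<open>L' 0\<close>.
\<close>
lemma double_summation_poly:
  assumes "has_top_form n L P"
    and L': "\<And>i. L' (Suc (Suc i)) = - L i / of_nat (Suc i * Suc (Suc i))" "L' 1 = 0"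
    and L'0: "(\<Sum>i\<le>n + 2. L' i * (1/2) ^ i) = 0"
  shows "\<exists>Q. has_top_form (n + 2) L' Q \<and>
    (\<forall>c d p. c \<le> d \<and> p = 2 * d + 1 \<longrightarrow> eval2 Q (of_nat c) (of_nat p) =
       (\<Sum>j=Suc c..d. \<Sum>k<j. eval2 P (of_nat k) (of_nat p)))"
proof -
  obtain G where G: "has_top_form (Suc n) (\<lambda>i. if i = 0 then 0 else L (i - 1) / of_nat i) G"
    "\<And>m. fix_c G (of_nat m) = (\<Sum>k<m. fix_c P (of_nat k))"
    using summation_poly[OF assms(1)] by blast
  obtain S where S: "has_top_form (Suc (Suc n)) (\<lambda>i. if i = 0 then 0 else
        (if i - 1 = 0 then 0 else L (i - 1 - 1) / of_nat (i - 1)) / of_nat i) S"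
    "\<And>m. fix_c S (of_nat m) = (\<Sum>k<m. fix_c G (of_nat k))"
    using summation_poly[OF G(1)] by blast
  (* S sums G over j < c only; adding G includes the term j = c without
     changing the leading form. *)
  define H where "H = S + G"
  define h where "h = poly H [:-1/2, 1/2:]"
  define Q where "Q = [:h:] - H"
  have H: "has_top_form (n + 2) (\<lambda>i. if i = 0 then 0 else - L' i) H"
  proof -
    have "(\<lambda>i. if i = 0 then 0 else (if i - 1 = 0 then 0 else L (i - 1 - 1) / of_nat (i - 1)) / of_nat i)
        = (\<lambda>i. if i = 0 then 0 else - L' i)" (is "?f = ?g")
    proof
      fix i show "?f i = ?g i"
      proof (cases i)
        case (Suc r)
        show ?thesis
        proof (cases r)
          case (Suc q)
          show ?thesis unfolding \<open>i = Suc r\<close> Suc L'(1) of_nat_mult by simp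
        qed (use L'(2) Suc in simp)
      qed simp
    qed
    with has_top_form_add_lower[OF S(1) G(1)] show ?thesis by (simp add: H_def)
  qed
  have "(\<Sum>i\<le>n + 2. (if i = 0 then 0 else - L' i) * (1/2) ^ i) = (\<Sum>i\<le>n + 2. (if i = 0 then L' 0 else 0) - L' i * (1/2) ^ i)"
    by (rule sum.cong) auto
  also have "\<dots> = L' 0"
    using L'0 by (simp add: sum_subtractf)
  finally have h: "degree h \<le> n + 2" "coeff h (n + 2) = L' 0"
    using has_top_form_subst_linear[OF H, of "-1/2" "1/2"] by (simp_all add: h_def)
  have "has_top_form (n + 2) L' Q"
    unfolding has_top_form_iff
  proof (intro allI impI)
    fix i j assume "n + 2 \<le> i + j"
    thus "coeff (coeff Q i) j = (if i + j = n + 2 then L' i else 0)"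
      using H h by (cases i) (auto simp: Q_def has_top_form_iff coeff_eq_0)
  qed
  moreover have "eval2 Q (of_nat c) (of_nat p) = (\<Sum>j=Suc c..d. \<Sum>k<j. eval2 P (of_nat k) (of_nat p))"
    if cd: "c \<le> d" and p: "p = 2 * d + 1" for c d p
  proof -
    define e where "e = (\<lambda>j. eval2 G (of_nat j) (of_nat p))"
    have e: "e j = (\<Sum>k<j. eval2 P (of_nat k) (of_nat p))" for j
      by (simp add: e_def eval2_def G(2) poly_sum)
    have HS: "eval2 H (of_nat m) (of_nat p) = (\<Sum>j\<le>m. e j)" for m
      by (simp add: H_def eval2_def fix_c_def[of "S + G"] fix_c_def[of S, symmetric] fix_c_def[of G, symmetric]
          S(2) e_def poly_sum flip: lessThan_Suc_atMost)
    have "poly h (of_nat p) = eval2 H (of_nat d) (of_nat p)"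
      unfolding h_def poly_poly_const by (rule arg_cong2[of _ _ _ _ "eval2 H"]) (simp_all add: p field_simps)
    hence "eval2 Q (of_nat c) (of_nat p) = (\<Sum>j\<le>d. e j) - (\<Sum>j\<le>c. e j)"
      by (simp add: Q_def eval2_def fix_c_def HS[unfolded eval2_def fix_c_def])
    also have "(\<Sum>j\<le>d. e j) = (\<Sum>j\<le>c. e j) + (\<Sum>j=Suc c..d. e j)"
      using cd by (subst sum.union_disjoint[symmetric]) (auto intro: sum.cong)
    finally show ?thesis by (simp add: e)
  qed
  ultimately show ?thesis by blast
qed

section \<open>Cutting off the last lollipop\<close>
definition parity_sign :: "int \<Rightarrow> int" where
  "parity_sign n = (if even n then 1 else -1)"

lemma finite_colorings: "finite (colorings p g c)"
proof -
  let ?d = "(int p - 1) div 2"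
  have "colorings p g c \<subseteq> ({1..g} \<rightarrow>\<^sub>E {0..?d - 1}) \<times> ({1..g} \<rightarrow>\<^sub>E {0..?d - 1}) \<times> ({0..g} \<rightarrow>\<^sub>E {0..?d - 1})"
  proof
    fix z assume "z \<in> colorings p g c"
    then obtain a l k where z: "z = (a, l, k)" "(a, l, k) \<in> colorings p g c" by (cases z) auto
    from z(2) have "a i \<in> {0..?d - 1} \<and> l i \<in> {0..?d - 1}" if "i \<in> {1..g}" for i
      using that unfolding colorings_def Let_def by force
    moreover from z(2) have "k i \<in> {0..?d - 1}" if "i \<in> {0..g}" for i
      using that unfolding colorings_def Let_def by force
    ultimately show "z \<in> ({1..g} \<rightarrow>\<^sub>E {0..?d - 1}) \<times> ({1..g} \<rightarrow>\<^sub>E {0..?d - 1}) \<times> ({0..g} \<rightarrow>\<^sub>E {0..?d - 1})"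
      using z by (auto simp: colorings_def Let_def PiE_def)
  qed
  thus ?thesis by (rule finite_subset) (intro finite_SigmaI finite_PiE, auto)
qed

lemma \<delta>_signed_count:
  "\<delta> p g c = (\<Sum>(a, l, k)\<in>colorings p g c. parity_sign (int c + (\<Sum>i=1..g. a i)))"
proof -
  let ?P = "\<lambda>z :: (nat \<Rightarrow> int) \<times> (nat \<Rightarrow> int) \<times> (nat \<Rightarrow> int). even (int c + (\<Sum>i=1..g. fst z i))"
  have e: "{(a, l, k) \<in> colorings p g c. even (int c + (\<Sum>i=1..g. a i))} = colorings p g c \<inter> Collect ?P"
    and o: "{(a, l, k) \<in> colorings p g c. odd (int c + (\<Sum>i=1..g. a i))} = colorings p g c \<inter> - Collect ?P"
    by auto
  have "(\<Sum>(a, l, k)\<in>colorings p g c. parity_sign (int c + (\<Sum>i=1..g. a i)))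
      = (\<Sum>z\<in>colorings p g c. if ?P z then 1 else -1)"
    by (rule sum.cong) (auto simp: parity_sign_def)
  also have "\<dots> = \<delta> p g c"
    unfolding \<delta>_def num_even_def num_odd_def e o using finite_colorings[of p g c]
    by (simp add: sum.If_cases Int_def)
  finally show ?thesis by simp
qed

lemma alternating_sum:
  "(\<Sum>j<2 * n. (-1) ^ j * (D - int j)) = int n"
  by (induction n) auto

text \<open>
  The admissible pairs (stick color, loop color) for a last lollipop between the spine edges \<open>m\<close> and \<open>c\<close>; as
  for the spine and stick edges of the tree, half of the stick color is recorded.
\<close>
definition last_lollipop :: "int \<Rightarrow> int \<Rightarrow> int \<Rightarrow> (int \<times> int) set" where
  "last_lollipop d m c = {(x, y). 0 \<le> x \<and> x \<le> y \<and> y \<le> d - 1 \<and> \<bar>m - x\<bar> \<le> c \<and> c \<le> m + x \<and> m + x + c \<le> 2 * d - 1}"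

text \<open>
  A stick color \<open>x\<close> leaves \<open>d - x\<close> choices for the loop, and \<open>x\<close> runs from \<open>\<bar>c - m\<bar>\<close> to
  the smaller of \<open>c + m\<close> and \<open>2 d - 1 - c - m\<close>. Consecutive terms of the alternating sum pair up to \<open>1\<close>.
  For the first upper bound, the number of terms is odd: there are \<open>min c m\<close> pairs and a last term
  \<open>d - c - m\<close>. For the second one it is even: there are \<open>d - max c m\<close> pairs. Both totals are \<open>d - max c m\<close>.
\<close>
lemma last_lollipop_sum:
  assumes "0 \<le> c" "c < d" "0 \<le> m" "m < d"
  shows "(\<Sum>(x, y)\<in>last_lollipop d m c. parity_sign (c + m + x)) = d - max c m"
proof -
  define u where "u = min (c + m) (2 * d - 1 - c - m)"
  define w where "w = \<bar>c - m\<bar>"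
  have eq: "last_lollipop d m c = (SIGMA x:{w..u}. {x..d - 1})"
    using assms by (auto simp: last_lollipop_def u_def w_def)
  have u: "u < d" "w \<le> u + 1" using assms by (auto simp: u_def w_def)
  have "(\<Sum>(x, y)\<in>last_lollipop d m c. parity_sign (c + m + x)) = (\<Sum>x=w..u. parity_sign (c + m + x) * (d - x))"
    unfolding eq using u by (subst sum.Sigma[symmetric]) (auto intro!: sum.cong)
  also have "\<dots> = (\<Sum>j<nat (u - w + 1). (-1) ^ j * ((d - w) - int j))"
    by (rule sum.reindex_bij_witness[of _ "\<lambda>j. w + int j" "\<lambda>x. nat (x - w)"])
       (auto simp: parity_sign_def w_def minus_one_power_iff even_nat_iff algebra_simps abs_if split: if_splits)
  also have "\<dots> = d - max c m"
  proof (cases "c + m \<le> 2 * d - 1 - c - m")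
    case True
    hence "nat (u - w + 1) = Suc (2 * nat (min c m))" 
      using assms by (auto simp: u_def w_def)
    thus ?thesis using alternating_sum[of "d - w" "nat (min c m)"] assms
      by (simp add: w_def abs_if max_def min_def split: if_splits)
  next
    case False
    hence "nat (u - w + 1) = 2 * nat (d - max c m)"
      using assms by (auto simp: u_def w_def)
    thus ?thesis using alternating_sum[of "d - w" "nat (d - max c m)"] assms by simp
  qed
  finally show ?thesis .
qed

text \<open>
  A coloring for \<open>g + 1\<close> lollipops is a coloring for \<open>g\<close> lollipops with trunk color \<open>2 m\<close> together with a last
  lollipop between \<open>m\<close> and \<open>c\<close>.
\<close>
lemma sum_colorings_Suc:
  assumes "p \<ge> 1" and d: "d = (p - 1) div 2" and "c < d"
  shows "(\<Sum>z\<in>colorings p (Suc g) c. F z) =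
    (\<Sum>(m, (a, l, k), (x, y))\<in>(SIGMA m:{..<d}. colorings p g m \<times> last_lollipop (int d) (int m) (int c)).
        F (a(Suc g := x), l(Suc g := y), k(Suc g := int c)))"
proof -
  have d': "(int p - 1) div 2 = int d" using assms by (simp add: zdiv_int of_nat_diff)
  let ?i = "\<lambda>(m :: nat, (a, l, k), (x, y)). (a(Suc g := x), l(Suc g := y), k(Suc g := int c)) :: (nat \<Rightarrow> int) \<times> (nat \<Rightarrow> int) \<times> (nat \<Rightarrow> int)"
  let ?j = "\<lambda>(a :: nat \<Rightarrow> int, l :: nat \<Rightarrow> int, k :: nat \<Rightarrow> int). (nat (k g), (restrict a {1..g}, restrict l {1..g}, restrict k {0..g}), (a (Suc g), l (Suc g)))"
  have ext: "(restrict f {b..g})(Suc g := f (Suc g)) = f" if "f \<in> extensional {b..Suc g}" "b \<le> Suc g" for f :: "nat \<Rightarrow> int" and b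
    using that by (auto simp: fun_eq_iff extensional_def)
  have ext': "restrict (f(Suc g := v)) {b..g} = f" if "f \<in> extensional {b..g}" for f :: "nat \<Rightarrow> int" and b v
    using that by (auto simp: fun_eq_iff extensional_def)
  show ?thesis
  proof (rule sum.reindex_bij_witness[of _ ?i ?j])
    fix z assume "z \<in> colorings p (Suc g) c"
    then obtain a l k where z: "z = (a, l, k)" "(a, l, k) \<in> colorings p (Suc g) c" by (cases z) auto
    show "?i (?j z) = z" using z ext[of a 1] ext[of l 1] ext[of k 0]
      by (auto simp: colorings_def Let_def)
    thus "(\<lambda>(m, (a, l, k), (x, y)). F (a(Suc g := x), l(Suc g := y), k(Suc g := int c))) (?j z) = F z"
      by (simp add: z)
    have "0 \<le> k g" "k g \<le> int d - 1" using z(2) by (auto simp: colorings_def Let_def d')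
    moreover have "(restrict a {1..g}, restrict l {1..g}, restrict k {0..g}) \<in> colorings p g (nat (k g))"
      using z(2) \<open>0 \<le> k g\<close> by (auto simp: colorings_def Let_def d')
    moreover have "(a (Suc g), l (Suc g)) \<in> last_lollipop (int d) (k g) (int c)"
      using z(2) by (auto simp: colorings_def Let_def d' last_lollipop_def atLeastAtMostSuc_conv)
    ultimately show "?j z \<in> (SIGMA m:{..<d}. colorings p g m \<times> last_lollipop (int d) (int m) (int c))"
      by (simp add: z(1) nat_less_iff)
  next
    fix z assume "z \<in> (SIGMA m:{..<d}. colorings p g m \<times> last_lollipop (int d) (int m) (int c))"
    then obtain m a l k x y where z: "z = (m, (a, l, k), (x, y))" "m < d" "(a, l, k) \<in> colorings p g m"
      "(x, y) \<in> last_lollipop (int d) (int m) (int c)" by (cases z) auto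
    show "?j (?i z) = z" using z(3) ext'[of a 1 x] ext'[of l 1 y] ext'[of k 0 "int c"]
      by (auto simp: colorings_def Let_def z(1))
    have I: "(\<forall>i\<in>{1..Suc g}. Q i) \<longleftrightarrow> (\<forall>i\<in>{1..g}. Q i) \<and> Q (Suc g)"
      "(\<forall>i\<in>{0..Suc g}. Q i) \<longleftrightarrow> (\<forall>i\<in>{0..g}. Q i) \<and> Q (Suc g)" for Q
      by (simp_all add: atLeastAtMostSuc_conv conj_commute)
    show "?i z \<in> colorings p (Suc g) c"
      using z(3,4) \<open>c < d\<close> unfolding z(1)
      by (auto simp: colorings_def Let_def d' last_lollipop_def I extensional_def)
  qed
qed

lemma \<delta>_Suc:
  assumes "p \<ge> 1" and d: "d = (p - 1) div 2" and "c < d"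
  shows "\<delta> p (Suc g) c = (\<Sum>m<d. (int d - max (int c) (int m)) * \<delta> p g m)"
proof -
  have fin: "finite (last_lollipop (int d) (int m) (int c))" for m
    by (rule finite_subset[of _ "{0..int d} \<times> {0..int d}"]) (auto simp: last_lollipop_def)
  have sgn: "parity_sign (int c + (\<Sum>i=1..Suc g. (a(Suc g := x)) i))
     = parity_sign (int m + (\<Sum>i=1..g. a i)) * parity_sign (int c + int m + x)" for a x m
  proof -
    have "(\<Sum>i=1..Suc g. (a(Suc g := x)) i) = (\<Sum>i=1..g. a i) + x"
      by (auto intro: sum.cong)
    thus ?thesis by (simp only: parity_sign_def) auto
  qed
  have "\<delta> p (Suc g) c = (\<Sum>(m, (a, l, k), (x, y))\<in>(SIGMA m:{..<d}. colorings p g m \<times> last_lollipop (int d) (int m) (int c)).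
        parity_sign (int m + (\<Sum>i=1..g. a i)) * parity_sign (int c + int m + x))"
    unfolding \<delta>_signed_count sum_colorings_Suc[OF assms]
    by (rule sum.cong[OF refl]) (clarsimp simp only: split_def prod.case sgn fst_conv snd_conv split_beta)
  also have "\<dots> = (\<Sum>m<d. \<Sum>(a, l, k)\<in>colorings p g m. \<Sum>(x, y)\<in>last_lollipop (int d) (int m) (int c).
        parity_sign (int m + (\<Sum>i=1..g. a i)) * parity_sign (int c + int m + x))"
    by (subst sum.Sigma[symmetric]) (auto simp: finite_colorings fin sum.cartesian_product split_def)
  also have "\<dots> = (\<Sum>m<d. (int d - max (int c) (int m)) * \<delta> p g m)"
  proof (rule sum.cong[OF refl])
    fix m assume "m \<in> {..<d}"
    hence ll: "(\<Sum>(x, y)\<in>last_lollipop (int d) (int m) (int c). parity_sign (int c + int m + x)) = int d - max (int c) (int m)"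
      using \<open>c < d\<close> by (intro last_lollipop_sum) auto
    show "(\<Sum>(a, l, k)\<in>colorings p g m. \<Sum>(x, y)\<in>last_lollipop (int d) (int m) (int c).
        parity_sign (int m + (\<Sum>i=1..g. a i)) * parity_sign (int c + int m + x))
      = (int d - max (int c) (int m)) * \<delta> p g m"
      unfolding \<delta>_signed_count ll[symmetric]
      by (simp add: sum_product split_def mult.commute sum.swap[of _ "colorings p g m"])
  qed
  finally show ?thesis .
qed

lemma \<delta>_0:
  assumes "p \<ge> 3"
  shows "\<delta> p 0 c = (if c = 0 then 1 else 0)"
proof -
  have "colorings p 0 c = (if c = 0 then {(\<lambda>_. undefined, \<lambda>_. undefined, \<lambda>i. if i = 0 then 0 else undefined)} else {})"
    using assms by (auto simp: colorings_def Let_def extensional_def fun_eq_iff)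
  thus ?thesis by (simp add: \<delta>_signed_count parity_sign_def)
qed

text \<open>
  The weight \<open>d - max c m\<close> is the number of \<open>j \<in> {c+1..d}\<close> with \<open>m < j\<close>; exchanging the two sums
  turns the recursion into an iterated sum.
\<close>
lemma \<delta>_Suc_double_sum:
  assumes "p \<ge> 1" and d: "d = (p - 1) div 2" and "c < d"
  shows "\<delta> p (Suc g) c = (\<Sum>j=Suc c..d. \<Sum>k<j. \<delta> p g k)"
proof -
  have "(\<Sum>j=Suc c..d. \<Sum>k<j. \<delta> p g k) = (\<Sum>j=Suc c..d. \<Sum>k<d. if k < j then \<delta> p g k else 0)"
    by (intro sum.cong refl sum.mono_neutral_cong_left) auto
  also have "\<dots> = (\<Sum>k<d. \<Sum>j=Suc c..d. if k < j then \<delta> p g k else 0)"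
    by (rule sum.swap)
  also have "\<dots> = (\<Sum>k<d. (int d - max (int c) (int k)) * \<delta> p g k)"
  proof (rule sum.cong[OF refl])
    fix k assume "k \<in> {..<d}"
    have "{Suc c..d} \<inter> {j. k < j} = {Suc (max c k)..d}" by auto
    thus "(\<Sum>j=Suc c..d. if k < j then \<delta> p g k else 0) = (int d - max (int c) (int k)) * \<delta> p g k"
      using \<open>c < d\<close> \<open>k \<in> _\<close> by (simp add: sum.If_cases of_nat_diff of_nat_max)
  qed
  finally show ?thesis by (simp add: \<delta>_Suc[OF assms])
qed

lemma \<delta>_1:
  assumes "p \<ge> 3" "d = (p - 1) div 2" "c < d"
  shows "\<delta> p 1 c = int d - int c"
proof -
  have "\<delta> p 1 c = (\<Sum>m<d. (int d - max (int c) (int m)) * \<delta> p 0 m)"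
    unfolding One_nat_def by (rule \<delta>_Suc) (use assms in auto)
  also have "\<dots> = (\<Sum>m<d. if m = 0 then int d - int c else 0)"
    by (rule sum.cong) (use assms in \<open>auto simp: \<delta>_0\<close>)
  also have "\<dots> = int d - int c"
    using assms by simp
  finally show ?thesis .
qed

section \<open>The leading form of the signed count\<close>

text \<open>
  The coefficient of \<open>c^i p^(2g-1-i)\<close> in the leading form, that is, with \<open>k = 2 g - i\<close> in the sum of the theorem.
\<close>
definition top_coeff :: "nat \<Rightarrow> nat \<Rightarrow> rat" where
  "top_coeff g i = (-1) ^ (g - 1) * genocchi_coeff (2 * g - i) / fact i"

lemma top_coeff_sum: "g \<ge> 1 \<Longrightarrow> (\<Sum>i\<le>2 * g - 1. top_coeff g i * (1/2) ^ i) = 0"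
proof -
  assume "g \<ge> 1"
  have "(\<Sum>i\<le>2 * g - 1. top_coeff g i * (1/2) ^ i)
      = (-1) ^ (g - 1) * (\<Sum>i\<le>2 * g - 1. genocchi_coeff (2 * g - i) / fact i * (1/2) ^ i)"
    by (simp add: top_coeff_def sum_distrib_left mult.assoc)
  thus ?thesis using genocchi_coeff_sum[OF \<open>g \<ge> 1\<close>] by simp
qed

text \<open>
  The claimed leading forms satisfy the boundary value problem of \<open>double_summation_poly\<close>, so the recursion carries
  the statement from \<open>g\<close> to \<open>g + 1\<close>. The start is \<open>g = 1\<close>: the count \<open>\<delta>\<^sub>0\<close> is an indicator
  function and not a polynomial.
\<close>
lemma \<delta>_polynomial:
  assumes "g \<ge> 1"
  shows "\<exists>P. has_top_form (2 * g - 1) (top_coeff g) P \<and>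
    (\<forall>c d p. c < d \<and> p = 2 * d + 1 \<longrightarrow> of_int (\<delta> p g c) = eval2 P (of_nat c) (of_nat p))"
  using assms
proof (induction g rule: nat_induct_at_least)
  case base
  define P :: "rat poly poly" where "P = [:[:-1/2, 1/2:], [:-1:]:]"
  have "top_coeff 1 1 = -1" by (simp add: top_coeff_def genocchi_coeff_1[simplified])
  moreover from this have "top_coeff 1 0 = 1/2" using top_coeff_sum[of 1] by simp
  ultimately have "has_top_form 1 (top_coeff 1) P"
    by (auto simp: has_top_form_iff P_def coeff_pCons split: nat.splits)
  moreover have "of_int (\<delta> (2 * d + 1) 1 c) = eval2 P (of_nat c) (of_nat (2 * d + 1))" if "c < d" for c d
    using that \<delta>_1[of "2 * d + 1" d c] by (simp add: P_def eval2_def fix_c_def field_simps)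
  ultimately show ?case by (intro exI[of _ P]) auto
next
  case (Suc g)
  then obtain P where P: "has_top_form (2 * g - 1) (top_coeff g) P"
    "\<And>c d p. c < d \<Longrightarrow> p = 2 * d + 1 \<Longrightarrow> of_int (\<delta> p g c) = eval2 P (of_nat c) (of_nat p)"
    by blast
  have n: "2 * g - 1 + 2 = 2 * Suc g - 1" using Suc.hyps by simp
  have step: "top_coeff (Suc g) (Suc (Suc i)) = - top_coeff g i / of_nat (Suc i * Suc (Suc i))" for i
  proof -
    have "2 * Suc g - Suc (Suc i) = 2 * g - i" by simp
    moreover have "(fact (Suc (Suc i)) :: rat) = of_nat (Suc i * Suc (Suc i)) * fact i"
      by (simp add: algebra_simps)
    moreover have "(-1 :: rat) ^ (Suc g - 1) = - ((-1) ^ (g - 1))"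
      using Suc.hyps by (cases g) auto
    ultimately show ?thesis
      unfolding top_coeff_def by (simp del: of_nat_Suc of_nat_mult fact_Suc power_Suc)
  qed
  have at_0: "top_coeff (Suc g) 1 = 0"
    using Suc.hyps by (simp add: top_coeff_def genocchi_coeff_odd)
  have at_half: "(\<Sum>i\<le>2 * g - 1 + 2. top_coeff (Suc g) i * (1/2) ^ i) = 0"
    unfolding n by (rule top_coeff_sum) simp
  obtain Q where Q: "has_top_form (2 * g - 1 + 2) (top_coeff (Suc g)) Q"
    "\<And>c d p. c \<le> d \<Longrightarrow> p = 2 * d + 1 \<Longrightarrow> eval2 Q (of_nat c) (of_nat p) =
       (\<Sum>j=Suc c..d. \<Sum>k<j. eval2 P (of_nat k) (of_nat p))"
    using double_summation_poly[OF P(1) step at_0 at_half] by blast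
  have "of_int (\<delta> p (Suc g) c) = eval2 Q (of_nat c) (of_nat p)" if cd: "c < d" "p = 2 * d + 1" for c d p
  proof -
    have "\<delta> p (Suc g) c = (\<Sum>j=Suc c..d. \<Sum>k<j. \<delta> p g k)"
      using cd by (intro \<delta>_Suc_double_sum) auto
    also have "rat_of_int \<dots> = (\<Sum>j=Suc c..d. \<Sum>k<j. eval2 P (of_nat k) (of_nat p))"
      unfolding of_int_sum by (intro sum.cong refl P(2)[of _ d]) (use cd in auto)
    finally show ?thesis using Q(2)[of c d p] cd by simp
  qed
  with Q(1) show ?case unfolding n by blast
qed

lemma total_degree_eq:
  assumes "has_top_form n L P" "i \<le> n" "L i \<noteq> 0"
  shows "total_degree P = n"
proof -
  let ?S = "{i + j | i j. coeff (coeff P i) j \<noteq> 0}"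
  have "?S \<subseteq> {..n}" using assms(1) by (force simp: has_top_form_def not_less)
  moreover have "coeff (coeff P i) (n - i) \<noteq> 0" using assms by (simp add: has_top_form_def)
  hence "n \<in> ?S" using assms(2) by (intro CollectI exI[of _ i] exI[of _ "n - i"]) simp
  ultimately show ?thesis unfolding total_degree_def
    by (intro Max_eqI) (auto intro: finite_subset[of _ "{..n}"])
qed

lemma homogeneous_part_eq:
  "has_top_form n L P \<Longrightarrow> homogeneous_part n P = (\<Sum>i\<le>n. bimonom (L i) i (n - i))"
  unfolding homogeneous_part_def has_top_form_def by (intro sum.cong) auto

lemma bimonom_sign: "(-1) ^ m * bimonom q i j = bimonom ((-1) ^ m * q) i j"
  by (simp add: minus_one_power_iff bimonom_def minus_monom)

theorem theorem2p8:
  fixes g :: nat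
  assumes "g \<ge> 1"
  shows "\<exists>P :: rat poly poly.
    (\<forall>p c :: nat. prime p \<and> p \<ge> 5 \<and> c \<le> (p - 3) div 2 \<longrightarrow>
       of_int (\<delta> p g c) = eval2 P (of_nat c) (of_nat p)) \<and>
    total_degree P = 2 * g - 1 \<and>
    homogeneous_part (2 * g - 1) P =
      (-1) ^ (g - 1) *
      (\<Sum>k=1..2 * g. bimonom (2 * (2 ^ k - 1) * (bernoulli k / fact k) * (1 / fact (2 * g - k)))
                      (2 * g - k) (k - 1)) \<and>
    (\<forall>c :: nat. degree (fix_c P (of_nat c)) = 2 * g - 1 \<and>
       lead_coeff (fix_c P (of_nat c)) = 4 * (2 ^ (2 * g) - 1) * bernoulli_tilde g)"
proof -
  obtain P where P: "has_top_form (2 * g - 1) (top_coeff g) P"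
    "\<And>c d p. c < d \<Longrightarrow> p = 2 * d + 1 \<Longrightarrow> of_int (\<delta> p g c) = eval2 P (of_nat c) (of_nat p)"
    using \<delta>_polynomial[OF assms] by blast
  have "of_int (\<delta> p g c) = eval2 P (of_nat c) (of_nat p)"
    if p: "prime p" "p \<ge> 5" "c \<le> (p - 3) div 2" for p c
  proof -
    have "odd p" using p prime_odd_nat[of p] by simp
    then obtain d where "p = 2 * d + 1" by (elim oddE)
    thus ?thesis using p by (intro P(2)[of c d]) auto
  qed
  (* The monomial c^(2g-1) occurs because its coefficient contains b_1 = -1. *)
  moreover have "total_degree P = 2 * g - 1"
    using P(1) by (rule total_degree_eq[where i = "2 * g - 1"])
      (use assms genocchi_coeff_1 in \<open>auto simp: top_coeff_def\<close>)
  moreover have "homogeneous_part (2 * g - 1) P = (-1) ^ (g - 1) *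
      (\<Sum>k=1..2 * g. bimonom (2 * (2 ^ k - 1) * (bernoulli k / fact k) * (1 / fact (2 * g - k))) (2 * g - k) (k - 1))"
    unfolding homogeneous_part_eq[OF P(1)] sum_distrib_left bimonom_sign
    by (rule sum.reindex_bij_witness[of _ "\<lambda>k. 2 * g - k" "\<lambda>i. 2 * g - i"])
       (use assms in \<open>auto simp: top_coeff_def genocchi_coeff_def\<close>)
  moreover have "degree (fix_c P (of_nat c)) = 2 * g - 1 \<and>
      lead_coeff (fix_c P (of_nat c)) = 4 * (2 ^ (2 * g) - 1) * bernoulli_tilde g" for c :: nat
  proof -
    (* For constant c, only the monomial p^(2g-1) of P can contribute to this coefficient. *)
    have "coeff (fix_c P (of_nat c)) (2 * g - 1) = (\<Sum>i\<le>2 * g - 1. top_coeff g i * 0 ^ i)"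
      using has_top_form_subst_linear(2)[OF P(1), of "of_nat c" 0] by (simp add: fix_c_def)
    also have "\<dots> = top_coeff g 0"
      by (simp add: power_0_left if_distrib[of "\<lambda>x. _ * x"] cong: if_cong)
    finally have lc: "coeff (fix_c P (of_nat c)) (2 * g - 1) = top_coeff g 0" .
    moreover have "top_coeff g 0 > 0"
      using genocchi_coeff_even_sign[OF assms] by (simp add: top_coeff_def)
    moreover have "degree (fix_c P (of_nat c)) \<le> 2 * g - 1"
      using has_top_form_subst_linear(1)[OF P(1), of "of_nat c" 0] by (simp add: fix_c_def)
    ultimately have "degree (fix_c P (of_nat c)) = 2 * g - 1"
      by (intro antisym le_degree) auto
    moreover have "top_coeff g 0 = 4 * (2 ^ (2 * g) - 1) * bernoulli_tilde g"
      using assms by (cases g) (simp_all add: top_coeff_def genocchi_coeff_def bernoulli_tilde_def field_simps del: fact_Suc)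
    ultimately show ?thesis using lc by simp
  qed
  ultimately show ?thesis by blast
qed

end
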